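(* Let $m\ge 1$ be an integer. There is a compact set $K\subset\mathbb{R}$ and jets $F$, $G$, $H$ of order $m$ on $K$ such that (1) $F$, $G$, and $H$ are Whitney fields of class $C^m$ on $K$, and (2) for every $1\le k\le m$ and $t\in K$, $$H^{k}(t) = \mathcal{P}^k \left(F^0(t),G^0(t),F^1(t),G^1(t),\dots,F^{k}(t),G^{k}(t)\right),$$ but there is no $C^m$ horizontal curve $(f,g,h)\colon\mathbb{R}\to\mathbb{H}^1$ extending the triple $(F,G,H)$.
   Context: Heisenberg group: $\mathbb{H}^1$ is $\mathbb{R}^3$ with group law $(x,y,t)(x',y',t')=(x+x',y+y',t+t'+2(yx'-xy'))$ and horizontal vector fields $X=\partial_x+2y\partial_t$, $Y=\partial_y-2x\partial_t$. An absolutely continuous curve is horizontal if at almost every time its derivative lies in the span of $X,Y$ at the point of the curve; for a $C^m$ curve $(f,g,h)$ with $m\ge1$ this means $h'=2(f'g-g'f)$ everywhere. Jets: a jet of order $m$ on $K\subset\mathbb{R}$ is a collection $F=(F^k)_{k=0}^m$ of continuous real-valued functions on $K$. The jet $F$ is a Whitney field of class $C^m$ on $K$ if for every $0\le k\le m$, $F^k(b)-\sum_{\ell=0}^{m-k}\frac{F^{k+\ell}(a)}{\ell!}(b-a)^\ell=o(|a-b|^{m-k})$ uniformly as $|a-b|\to0$ with $a,b\in K$. A $C^m$ horizontal curve $(f,g,h)\colon\mathbb{R}\to\mathbb{H}^1$ extends the triple $(F,G,H)$ of jets of order $m$ on $K$ if $D^kf(x)=F^k(x)$, $D^kg(x)=G^k(x)$,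 $D^kh(x)=H^k(x)$ for all $x\in K$ and $0\le k\le m$. Polynomials $\mathcal{P}^k$: for $1\le k\le m$, $\mathcal{P}^k$ is the polynomial obtained by differentiating $h'=2(f'g-g'f)$ $k-1$ times by the Leibniz rule; explicitly $\mathcal{P}^k(x_0,y_0,x_1,y_1,\dots,x_k,y_k)=2\sum_{j=0}^{k-1}\binom{k-1}{j}(x_{j+1}y_{k-1-j}-y_{j+1}x_{k-1-j})$. *)

theory Defs
  imports "HOL-Analysis.Analysis"
begin

(* A jet is a family of total functions; only the values F k t with k \<le> m and t \<in> K matter. *)
definition is_jet :: "nat \<Rightarrow> real set \<Rightarrow> (nat \<Rightarrow> real \<Rightarrow> real) \<Rightarrow> bool" where
  "is_jet m K F \<longleftrightarrow> (\<forall>k\<le>m. continuous_on K (F k))"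

(* For a = b the inequality reads 0 \<le> \<epsilon> * 0 ^ (m - k), so including the diagonal is harmless. *)
definition whitney_field :: "nat \<Rightarrow> real set \<Rightarrow> (nat \<Rightarrow> real \<Rightarrow> real) \<Rightarrow> bool" where
  "whitney_field m K F \<longleftrightarrow> is_jet m K F \<and>
    (\<forall>k\<le>m. \<forall>\<epsilon>>0. \<exists>\<delta>>0. \<forall>a\<in>K. \<forall>b\<in>K. \<bar>a - b\<bar> < \<delta> \<longrightarrow>
      \<bar>F k b - (\<Sum>l=0..m-k. F (k + l) a / fact l * (b - a) ^ l)\<bar> \<le> \<epsilon> * \<bar>a - b\<bar> ^ (m - k))"

definition C_m_function :: "nat \<Rightarrow> (real \<Rightarrow> real) \<Rightarrow> bool" where
  "C_m_function m f \<longleftrightarrow>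
    (\<forall>k<m. \<forall>t. (deriv ^^ k) f field_differentiable (at t)) \<and>
    (\<forall>k\<le>m. continuous_on UNIV ((deriv ^^ k) f))"

(* The underlying set of the first Heisenberg group. The group law enters only through
   the vector fields X and Y below, so it is not recorded. *)
type_synonym heisenberg = "real \<times> real \<times> real"

fun heis_X :: "heisenberg \<Rightarrow> real \<times> real \<times> real" where
  "heis_X (x, y, t) = (1, 0, 2 * y)"

fun heis_Y :: "heisenberg \<Rightarrow> real \<times> real \<times> real" where
  "heis_Y (x, y, t) = (0, 1, - 2 * x)"

(* A curve on the whole line is called absolutely continuous if it is so on every
   compact interval. A pair (u, v) stands for the interval from u to v. *)
definition absolutely_continuous_curve :: "(real \<Rightarrow> heisenberg) \<Rightarrow> bool" where
  "absolutely_continuous_curve \<gamma> \<longleftrightarrow>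
    (\<forall>a b. \<forall>\<epsilon>>0. \<exists>\<delta>>0. \<forall>I :: (real \<times> real) set.
      finite I \<and> (\<forall>(u, v)\<in>I. a \<le> u \<and> u \<le> v \<and> v \<le> b) \<and>
      disjoint_family_on (\<lambda>(u, v). {u<..<v}) I \<and> (\<Sum>(u, v)\<in>I. v - u) < \<delta>
      \<longrightarrow> (\<Sum>(u, v)\<in>I. dist (\<gamma> u) (\<gamma> v)) < \<epsilon>)"

definition horizontal_curve :: "(real \<Rightarrow> heisenberg) \<Rightarrow> bool" where
  "horizontal_curve \<gamma> \<longleftrightarrow> absolutely_continuous_curve \<gamma> \<and>
    (AE t in lborel. \<exists>v \<in> span {heis_X (\<gamma> t), heis_Y (\<gamma> t)}. (\<gamma> has_vector_derivative v) (at t))"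

definition C_m_horizontal_curve ::
    "nat \<Rightarrow> (real \<Rightarrow> real) \<Rightarrow> (real \<Rightarrow> real) \<Rightarrow> (real \<Rightarrow> real) \<Rightarrow> bool" where
  "C_m_horizontal_curve m f g h \<longleftrightarrow>
    C_m_function m f \<and> C_m_function m g \<and> C_m_function m h \<and>
    horizontal_curve (\<lambda>t. (f t, g t, h t))"

definition extends_jet :: "nat \<Rightarrow> real set \<Rightarrow> (nat \<Rightarrow> real \<Rightarrow> real) \<Rightarrow> (real \<Rightarrow> real) \<Rightarrow> bool" where
  "extends_jet m K F f \<longleftrightarrow> (\<forall>x\<in>K. \<forall>k\<le>m. (deriv ^^ k) f x = F k x)"

(* The Leibniz expansion of the (k-1)-st derivative of 2 (f' g - g' f), for k \<ge> 1, with
   x i and y i in place of the i-th derivatives of f and g. Only x 0, ..., x k and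
   y 0, ..., y k occur. *)
definition heis_poly :: "nat \<Rightarrow> (nat \<Rightarrow> real) \<Rightarrow> (nat \<Rightarrow> real) \<Rightarrow> real" where
  "heis_poly k x y =
    2 * (\<Sum>j=0..k-1. of_nat ((k - 1) choose j) *
          (x (j + 1) * y (k - 1 - j) - y (j + 1) * x (k - 1 - j)))"

end

theory Submission
  imports Defs
begin

text \<open>
  Take \<open>F = G = 0\<close> and let \<open>H\<close> be the jet with \<open>H\<^sup>0(t) = t\<^bsup>2m\<^esup>\<close> and vanishing higher entries on
  \<open>K = {0} \<union> {2\<^bsup>-n\<^esup>}\<close>. Since \<open>K\<close> is lacunary, the increments of \<open>H\<^sup>0\<close> between points of \<open>K\<close> are of
  order \<open>\<bar>b - a\<bar>\<^bsup>2m\<^esup>\<close>, so \<open>H\<close> is a Whitney field. In an extension, \<open>f\<close> and \<open>g\<close> are flat to order \<open>m\<close>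
  at \<open>0\<close>, so the horizontality equation \<open>h' = 2 (f' g - g' f)\<close> forces \<open>h(t) - h(0) = o(t\<^bsup>2m\<^esup>)\<close>,
  which contradicts \<open>h(t) = t\<^bsup>2m\<^esup>\<close> on \<open>K\<close>.
\<close>

section \<open>Functions of class C^m that are flat at 0\<close>

lemma C_m_function_deriv:
  assumes "C_m_function (Suc m) f"
  shows "C_m_function m (deriv f)"
  using assms unfolding C_m_function_def
  by (metis Suc_le_mono Suc_less_eq funpow_simps_right(2) o_apply)

lemma C_m_function_has_real_derivative:
  assumes "C_m_function m f" "1 \<le> m"
  shows "(f has_real_derivative deriv f t) (at t)"
proof -
  have "(deriv ^^ 0) f field_differentiable at t"
    using assms unfolding C_m_function_def by (metis less_eq_Suc_le One_nat_def)
  then show ?thesis by (simp add: DERIV_deriv_iff_field_differentiable)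
qed

lemma C_m_function_continuous_deriv:
  assumes "C_m_function m f" "1 \<le> m"
  shows "continuous_on UNIV (deriv f)"
proof -
  have "continuous_on UNIV ((deriv ^^ 1) f)"
    using assms unfolding C_m_function_def by blast
  then show ?thesis by simp
qed

text \<open>By the mean value theorem the increment is \<open>t\<close> times \<open>f'\<close> at
  an interior point. The constant \<open>C\<close> stays the same, so the bound can be
  iterated.\<close>

lemma abs_increment_le_bound:
  fixes f f' :: "real \<Rightarrow> real"
  assumes "\<And>s. \<lbrakk>0 \<le> s; s \<le> t\<rbrakk> \<Longrightarrow> (f has_real_derivative f' s) (at s)"
    and "\<And>s. \<lbrakk>0 < s; s < t\<rbrakk> \<Longrightarrow> \<bar>f' s\<bar> \<le> C * s ^ n"
    and "0 \<le> C" "0 \<le> t"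
  shows "\<bar>f t - f 0\<bar> \<le> C * t ^ Suc n"
proof (cases "t = 0")
  case False
  with assms(4) have "0 < t" by simp
  from MVT2[OF this, of f f'] assms(1)
  obtain z where z: "0 < z" "z < t" "f t - f 0 = (t - 0) * f' z"
    by auto
  have "\<bar>f t - f 0\<bar> = t * \<bar>f' z\<bar>"
    using z \<open>0 < t\<close> by (simp add: abs_mult)
  also have "\<dots> \<le> t * (C * z ^ n)"
    using assms(2) z \<open>0 < t\<close> by (intro mult_left_mono) auto
  also have "\<dots> \<le> t * (C * t ^ n)"
    using z assms(3) \<open>0 < t\<close> by (intro mult_left_mono power_mono) auto
  finally show ?thesis by (simp add: mult_ac)
qed (use assms(3) in simp)

text \<open>Taylor's theorem with Peano remainder for a vanishing jet, to the right of 0. In the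
  induction \<open>deriv f\<close> is flat to one order less, and the mean value bound regains that
  order; the base case is continuity at 0.\<close>

lemma flat_function_bound:
  assumes "C_m_function m f" "\<And>k. k \<le> m \<Longrightarrow> (deriv ^^ k) f 0 = 0" "0 < \<epsilon>"
  shows "\<exists>\<delta>>0. \<forall>t. 0 \<le> t \<and> t < \<delta> \<longrightarrow> \<bar>f t\<bar> \<le> \<epsilon> * t ^ m"
  using assms(1,2)
proof (induction m arbitrary: f)
  case 0
  have "continuous_on UNIV f" "f 0 = 0"
    using "0.prems"(1) "0.prems"(2)[of 0] by (auto simp: C_m_function_def)
  then obtain \<delta> where "\<delta> > 0" "\<And>t. dist t 0 < \<delta> \<Longrightarrow> dist (f t) (f 0) < \<epsilon>"
    using assms(3) unfolding continuous_on_iff by (metis UNIV_I)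
  with \<open>f 0 = 0\<close> show ?case
    by (intro exI[of _ \<delta>]) (auto simp: dist_real_def intro!: less_imp_le)
next
  case (Suc m)
  have "(deriv ^^ k) (deriv f) 0 = 0" if "k \<le> m" for k
    using Suc.prems(2)[of "Suc k"] that by (simp add: funpow_swap1)
  with Suc.IH[OF C_m_function_deriv[OF Suc.prems(1)]]
  obtain \<delta> where \<delta>: "\<delta> > 0" "\<And>t. 0 \<le> t \<and> t < \<delta> \<Longrightarrow> \<bar>deriv f t\<bar> \<le> \<epsilon> * t ^ m"
    by blast
  have "f 0 = 0"
    using Suc.prems(2)[of 0] by simp
  have "\<bar>f t\<bar> \<le> \<epsilon> * t ^ Suc m" if "0 \<le> t" "t < \<delta>" for t
    using abs_increment_le_bound[of t f "deriv f" \<epsilon> m] \<delta>(2) that \<open>0 < \<epsilon>\<close> \<open>f 0 = 0\<close>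
      C_m_function_has_real_derivative[OF Suc.prems(1)] by simp
  with \<delta>(1) show ?case by blast
qed

section \<open>The horizontality equation and its effect on flat curves\<close>

lemma span_heis_has_vector_derivative:
  assumes "v \<in> span {heis_X (f t, g t, h t), heis_Y (f t, g t, h t)}"
    and "((\<lambda>t. (f t, g t, h t)) has_vector_derivative v) (at t)"
  shows "deriv h t = 2 * (deriv f t * g t - deriv g t * f t)"
proof -
  obtain v1 v2 v3 where v: "v = (v1, v2, v3)" by (cases v)
  \<comment> \<open>The first two components of X and Y are the unit vectors, so the coefficients of
    \<open>v\<close> must be \<open>v1\<close> and \<open>v2\<close>; the third component is then
    determined.\<close>
  have span: "v3 = 2 * (v1 * g t - v2 * f t)"
    using assms(1) unfolding v
    by (auto simp: span_breakdown_eq zero_prod_def algebra_simps)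
  have "(f has_vector_derivative v1) (at t)"
    using bounded_linear.has_vector_derivative[OF bounded_linear_fst assms(2)] by (simp add: v)
  moreover have snd: "((\<lambda>t. (g t, h t)) has_vector_derivative (v2, v3)) (at t)"
    using bounded_linear.has_vector_derivative[OF bounded_linear_snd assms(2)] by (simp add: v)
  have "(g has_vector_derivative v2) (at t)"
    using bounded_linear.has_vector_derivative[OF bounded_linear_fst snd] by simp
  moreover have "(h has_vector_derivative v3) (at t)"
    using bounded_linear.has_vector_derivative[OF bounded_linear_snd snd] by simp
  ultimately have "deriv f t = v1" "deriv g t = v2" "deriv h t = v3"
    by (auto intro: DERIV_imp_deriv simp: has_real_derivative_iff_has_vector_derivative)
  with span show ?thesis by simp
qed

text \<open>Horizontality holds only almost everywhere by definition. Both sides of the equation are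
  continuous, so it holds on a closed set of full measure, which is the whole line.\<close>

lemma C_m_horizontal_curve_deriv:
  assumes "C_m_horizontal_curve m f g h" "1 \<le> m"
  shows "deriv h t = 2 * (deriv f t * g t - deriv g t * f t)"
proof -
  have C_m: "C_m_function m f" "C_m_function m g" "C_m_function m h"
    and hor: "horizontal_curve (\<lambda>t. (f t, g t, h t))"
    using assms(1) by (auto simp: C_m_horizontal_curve_def)
  note [continuous_intros] = C_m[THEN C_m_function_continuous_deriv, OF assms(2)]
  have [continuous_intros]: "continuous_on UNIV f" "continuous_on UNIV g"
    using C_m_function_has_real_derivative[OF _ assms(2)] C_m
    by (auto intro!: DERIV_continuous_on simp del: has_field_derivative_at_within
        intro: has_field_derivative_at_within)
  define S where "S = {t. deriv h t = 2 * (deriv f t * g t - deriv g t * f t)}"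
  have "closed S"
    unfolding S_def by (intro closed_Collect_eq continuous_intros)
  moreover have "AE t in lborel. t \<in> S"
    using hor span_heis_has_vector_derivative unfolding horizontal_curve_def S_def
    by (auto elim!: eventually_mono)
  then have "AE t in lebesgue. t \<in> S"
    by (rule AE_completion)
  ultimately show ?thesis
    using mem_closed_if_AE_lebesgue[of S t] by (simp add: S_def)
qed

text \<open>Each product in the horizontality equation pairs a factor o(t^m) with a derivative
  o(t^(m-1)). Hence \<open>deriv h\<close> is o(t^(2m-1)), and one more use of the mean value bound
  gives order 2m.\<close>

lemma horizontal_flat_increment:
  assumes "C_m_horizontal_curve m f g h" "1 \<le> m" "0 < \<epsilon>"
    and f0: "\<And>k. k \<le> m \<Longrightarrow> (deriv ^^ k) f 0 = 0"
    and g0: "\<And>k. k \<le> m \<Longrightarrow> (deriv ^^ k) g 0 = 0"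
  shows "\<exists>\<delta>>0. \<forall>t. 0 \<le> t \<and> t < \<delta> \<longrightarrow> \<bar>h t - h 0\<bar> \<le> \<epsilon> * t ^ (2 * m)"
proof -
  obtain n where m: "m = Suc n"
    using assms(2) by (cases m) auto
  have C_m: "C_m_function m f" "C_m_function m g" "C_m_function m h"
    using assms(1) by (auto simp: C_m_horizontal_curve_def)
  \<comment> \<open>Two products, each contributing \<eta>^2, and the outer factor 2 add up to 4
    \<eta>^2 = \<epsilon>.\<close>
  define \<eta> where "\<eta> = sqrt (\<epsilon> / 4)"
  have \<eta>: "\<eta> > 0" "4 * (\<eta> * \<eta>) = \<epsilon>"
    using assms(3) by (auto simp: \<eta>_def)
  have flat: "\<exists>\<delta>>0. \<forall>t. 0 \<le> t \<and> t < \<delta> \<longrightarrow> \<bar>u t\<bar> \<le> \<eta> * t ^ m \<and> \<bar>deriv u t\<bar> \<le> \<eta> * t ^ n"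
    if u: "C_m_function m u" "\<And>k. k \<le> m \<Longrightarrow> (deriv ^^ k) u 0 = 0" for u
  proof -
    have "(deriv ^^ k) (deriv u) 0 = 0" if "k \<le> n" for k
      using u(2)[of "Suc k"] that m by (simp add: funpow_swap1)
    with flat_function_bound[OF u \<eta>(1)]
      flat_function_bound[OF C_m_function_deriv[OF u(1)[unfolded m]] _ \<eta>(1)]
    obtain \<delta> \<delta>' where "\<delta> > 0" "\<delta>' > 0"
      and "\<forall>t. 0 \<le> t \<and> t < \<delta> \<longrightarrow> \<bar>u t\<bar> \<le> \<eta> * t ^ m"
      and "\<forall>t. 0 \<le> t \<and> t < \<delta>' \<longrightarrow> \<bar>deriv u t\<bar> \<le> \<eta> * t ^ n"
      by auto
    then show ?thesis by (intro exI[of _ "min \<delta> \<delta>'"]) auto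
  qed
  from flat[OF C_m(1) f0] flat[OF C_m(2) g0]
  obtain \<delta>f \<delta>g where \<delta>: "\<delta>f > 0" "\<delta>g > 0"
    and f: "\<And>t. 0 \<le> t \<Longrightarrow> t < \<delta>f \<Longrightarrow> \<bar>f t\<bar> \<le> \<eta> * t ^ m \<and> \<bar>deriv f t\<bar> \<le> \<eta> * t ^ n"
    and g: "\<And>t. 0 \<le> t \<Longrightarrow> t < \<delta>g \<Longrightarrow> \<bar>g t\<bar> \<le> \<eta> * t ^ m \<and> \<bar>deriv g t\<bar> \<le> \<eta> * t ^ n"
    by metis
  have h': "\<bar>deriv h t\<bar> \<le> \<epsilon> * t ^ (m + n)" if t: "0 \<le> t" "t < min \<delta>f \<delta>g" for t
  proof -
    have "\<bar>deriv f t\<bar> * \<bar>g t\<bar> \<le> (\<eta> * t ^ n) * (\<eta> * t ^ m)"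
         "\<bar>deriv g t\<bar> * \<bar>f t\<bar> \<le> (\<eta> * t ^ n) * (\<eta> * t ^ m)"
      using f g t \<eta>(1) by (auto intro!: mult_mono)
    then have "\<bar>deriv h t\<bar> \<le> 2 * (2 * ((\<eta> * t ^ n) * (\<eta> * t ^ m)))"
      unfolding C_m_horizontal_curve_deriv[OF assms(1,2), of t] abs_mult
      by (intro mult_mono) (auto simp flip: abs_mult)
    also have "\<dots> = \<epsilon> * t ^ (m + n)"
      by (simp add: \<eta>(2)[symmetric] power_add mult_ac)
    finally show ?thesis .
  qed
  have "\<bar>h t - h 0\<bar> \<le> \<epsilon> * t ^ (2 * m)" if t: "0 \<le> t" "t < min \<delta>f \<delta>g" for t
  proof -
    have "\<bar>h t - h 0\<bar> \<le> \<epsilon> * t ^ Suc (m + n)"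
      using C_m_function_has_real_derivative[OF C_m(3) assms(2)] h' t assms(3)
      by (intro abs_increment_le_bound[where f' = "deriv h"]) auto
    also have "Suc (m + n) = 2 * m" by (simp add: m)
    finally show ?thesis .
  qed
  then show ?thesis
    using \<delta> by (intro exI[of _ "min \<delta>f \<delta>g"]) auto
qed

section \<open>The lacunary set and the Whitney condition on it\<close>

lemma dyadic_le_twice_diff:
  fixes i j :: nat
  assumes "i < j"
  shows "(1/2) ^ i \<le> 2 * ((1/2) ^ i - (1/2) ^ j :: real)"
proof -
  have "(1/2 :: real) ^ j \<le> (1/2) ^ Suc i"
    using assms by (intro power_decreasing) auto
  then show ?thesis by simp
qed

definition dyadic_set :: "real set" where
  "dyadic_set = insert 0 (range (\<lambda>n. (1/2) ^ n))"

lemma compact_dyadic_set: "compact dyadic_set"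
  unfolding dyadic_set_def by (intro compact_sequence_with_limit LIMSEQ_power_zero) simp

text \<open>Lacunarity: every point of the set below \<open>b\<close> is at most
  \<open>b / 2\<close>, so the size of \<open>b\<close> is controlled by its distance to
  \<open>a\<close>.\<close>

lemma dyadic_set_gap:
  assumes "a \<in> dyadic_set" "b \<in> dyadic_set" "a < b"
  shows "0 \<le> a" "b \<le> 2 * (b - a)"
proof -
  show "0 \<le> a" using assms(1) by (auto simp: dyadic_set_def)
  with assms(2,3) obtain i where i: "b = (1/2) ^ i"
    by (auto simp: dyadic_set_def)
  show "b \<le> 2 * (b - a)"
  proof (cases "a = 0")
    case False
    with assms(1) obtain j where j: "a = (1/2) ^ j"
      by (auto simp: dyadic_set_def)
    with assms(3) i have "i < j"
      using power_decreasing[of j i "1/2 :: real"] by force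
    then show ?thesis using dyadic_le_twice_diff by (simp add: i j)
  qed (use assms in simp)
qed

text \<open>By symmetry let a < b. The increment is at most b^(2m), and the gap estimate replaces b
  by 2 (b - a); the constant is 4^m = 2^(2m).\<close>

lemma dyadic_set_power_diff:
  assumes "a \<in> dyadic_set" "b \<in> dyadic_set"
  shows "\<bar>b ^ (2 * m) - a ^ (2 * m)\<bar> \<le> 4 ^ m * \<bar>a - b\<bar> ^ (2 * m)"
  using assms
proof (induction a b rule: linorder_wlog)
  case (le a b)
  show ?case
  proof (cases "a = b")
    case False
    with le have ab: "0 \<le> a" "a < b" "b \<le> 2 * (b - a)"
      using dyadic_set_gap[of a b] by auto
    then have "a ^ (2 * m) \<le> b ^ (2 * m)" "0 \<le> a ^ (2 * m)"
      by (auto intro: power_mono)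
    then have "\<bar>b ^ (2 * m) - a ^ (2 * m)\<bar> \<le> b ^ (2 * m)"
      by simp
    also have "\<dots> \<le> (2 * (b - a)) ^ (2 * m)"
      using ab by (intro power_mono) auto
    also have "\<dots> = 4 ^ m * \<bar>a - b\<bar> ^ (2 * m)"
      using ab by (simp only: power_mult_distrib) (simp add: power_mult)
    finally show ?thesis .
  qed simp
next
  case (sym a b)
  then show ?case by (simp add: abs_minus_commute)
qed

lemma whitney_field_zero: "whitney_field m K (\<lambda>_ _. 0)"
  by (auto simp: whitney_field_def is_jet_def intro: exI[of _ 1])

text \<open>Away from 0 this is not the jet of t^(2m). The Taylor polynomial at \<open>a\<close> for
  k = 0 is the constant a^(2m), so the remainder is the increment just estimated, of order 2m > m.
  For k > 0 all terms vanish.\<close>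

lemma whitney_field_dyadic_power:
  assumes "1 \<le> m"
  shows "whitney_field m dyadic_set (\<lambda>k t. if k = 0 then t ^ (2 * m) else 0)"
    (is "whitney_field m _ ?H")
  unfolding whitney_field_def
proof (intro conjI allI impI)
  show "is_jet m dyadic_set ?H"
    unfolding is_jet_def
  proof (intro allI impI)
    fix k
    show "continuous_on dyadic_set (?H k)"
      by (cases "k = 0") (auto intro: continuous_intros)
  qed
  fix k :: nat and \<epsilon> :: real
  assume "k \<le> m" "0 < \<epsilon>"
  show "\<exists>\<delta>>0. \<forall>a\<in>dyadic_set. \<forall>b\<in>dyadic_set. \<bar>a - b\<bar> < \<delta> \<longrightarrow>
      \<bar>?H k b - (\<Sum>l=0..m-k. ?H (k + l) a / fact l * (b - a) ^ l)\<bar> \<le> \<epsilon> * \<bar>a - b\<bar> ^ (m - k)"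
  proof (cases "k = 0")
    case False
    then show ?thesis using \<open>0 < \<epsilon>\<close> by (auto intro: exI[of _ 1])
  next
    case True
    \<comment> \<open>The bound 1 gives |a - b|^m \<le> |a - b| since m \<ge> 1; the other bound
      absorbs the constant 4^m.\<close>
    define \<delta> where "\<delta> = min 1 (\<epsilon> / 4 ^ m)"
    have "\<delta> > 0" using \<open>0 < \<epsilon>\<close> by (simp add: \<delta>_def)
    moreover have "\<bar>?H k b - (\<Sum>l=0..m-k. ?H (k + l) a / fact l * (b - a) ^ l)\<bar>
        \<le> \<epsilon> * \<bar>a - b\<bar> ^ (m - k)"
      if ab: "a \<in> dyadic_set" "b \<in> dyadic_set" "\<bar>a - b\<bar> < \<delta>" for a b
    proof -
      have "(\<Sum>l=0..m. ?H l a / fact l * (b - a) ^ l) = a ^ (2 * m)"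
        by (subst sum.atLeast_Suc_atMost) auto
      then have "\<bar>?H k b - (\<Sum>l=0..m-k. ?H (k + l) a / fact l * (b - a) ^ l)\<bar>
          = \<bar>b ^ (2 * m) - a ^ (2 * m)\<bar>"
        using True by simp
      also have "\<dots> \<le> 4 ^ m * \<bar>a - b\<bar> ^ m * \<bar>a - b\<bar> ^ m"
        using dyadic_set_power_diff[OF ab(1,2), of m]
        unfolding mult_2 power_add mult.assoc .
      also have "\<dots> \<le> \<epsilon> * \<bar>a - b\<bar> ^ m"
      proof (intro mult_right_mono)
        have "\<bar>a - b\<bar> ^ m \<le> \<bar>a - b\<bar> ^ 1"
          using ab(3) assms by (intro power_decreasing) (auto simp: \<delta>_def)
        also have "\<dots> \<le> \<epsilon> / 4 ^ m"
          using ab(3) by (simp add: \<delta>_def)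
        finally show "4 ^ m * \<bar>a - b\<bar> ^ m \<le> \<epsilon>"
          by (simp add: field_simps)
      qed simp
      finally show ?thesis using True by simp
    qed
    ultimately show ?thesis by blast
  qed
qed

theorem proposition4p1:
  fixes m :: nat
  assumes "m \<ge> 1"
  shows "\<exists>(K :: real set) (F :: nat \<Rightarrow> real \<Rightarrow> real) (G :: nat \<Rightarrow> real \<Rightarrow> real) (H :: nat \<Rightarrow> real \<Rightarrow> real).
    compact K \<and> is_jet m K F \<and> is_jet m K G \<and> is_jet m K H \<and>
    whitney_field m K F \<and> whitney_field m K G \<and> whitney_field m K H \<and>
    (\<forall>k\<in>{1..m}. \<forall>t\<in>K. H k t = heis_poly k (\<lambda>i. F i t) (\<lambda>i. G i t)) \<and>
    \<not> (\<exists>f g h. C_m_horizontal_curve m f g h \<and>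
          extends_jet m K F f \<and> extends_jet m K G g \<and> extends_jet m K H h)"
proof -
  define Z :: "nat \<Rightarrow> real \<Rightarrow> real" where "Z = (\<lambda>_ _. 0)"
  define H :: "nat \<Rightarrow> real \<Rightarrow> real" where "H = (\<lambda>k t. if k = 0 then t ^ (2 * m) else 0)"
  have whitney: "whitney_field m dyadic_set Z" "whitney_field m dyadic_set H"
    unfolding Z_def H_def using assms by (auto intro: whitney_field_zero whitney_field_dyadic_power)
  have jets: "is_jet m dyadic_set Z" "is_jet m dyadic_set H"
    using whitney by (auto simp: whitney_field_def)
  \<comment> \<open>Every product in \<open>heis_poly\<close> has a factor from \<open>Z\<close>,
    and \<open>H k\<close> is zero for k \<ge> 1.\<close>
  have "H k t = heis_poly k (\<lambda>i. Z i t) (\<lambda>i. Z i t)" if "k \<in> {1..m}" for k t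
    using that by (simp add: heis_poly_def H_def Z_def)
  moreover have False
    if curve: "C_m_horizontal_curve m f g h"
      and ext: "extends_jet m dyadic_set Z f" "extends_jet m dyadic_set Z g"
        "extends_jet m dyadic_set H h" for f g h
  proof -
    have "0 \<in> dyadic_set" by (simp add: dyadic_set_def)
    with ext have "(deriv ^^ k) f 0 = 0" "(deriv ^^ k) g 0 = 0" if "k \<le> m" for k
      using that by (auto simp: extends_jet_def Z_def)
    \<comment> \<open>Any positive constant below 1 serves here: at dyadic points the increment of
      \<open>h\<close> from 0 equals t^(2m) exactly.\<close>
    from horizontal_flat_increment[OF curve assms, of "1/2", OF _ this]
    obtain \<delta> where \<delta>: "\<delta> > 0"
      and bound: "\<And>t. 0 \<le> t \<and> t < \<delta> \<Longrightarrow> \<bar>h t - h 0\<bar> \<le> 1/2 * t ^ (2 * m)"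
      by auto
    obtain n where n: "(1/2) ^ n < \<delta>"
      using real_arch_pow_inv[OF \<delta>, of "1/2"] by auto
    have "h t = t ^ (2 * m)" if "t \<in> dyadic_set" for t
      using ext(3) that by (auto simp: extends_jet_def H_def dest!: bspec spec[of _ "0::nat"])
    then have "h ((1/2) ^ n) = ((1/2) ^ n) ^ (2 * m)" "h 0 = 0"
      using assms by (auto simp: dyadic_set_def)
    moreover have "(((1/2) ^ n) ^ (2 * m) :: real) > 0" by simp
    ultimately show False
      using bound[of "(1/2) ^ n"] n by simp
  qed
  ultimately show ?thesis
    using compact_dyadic_set whitney jets by blast
qed

end
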